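(* Let $m$ be a positive integer and let $G$ be a $2m$-edge-connected graph with a factor $M$ satisfying $\Delta(M)\le m$. Then $G$ can be decomposed into (i.e., its edge set partitioned into the edge sets of) an $m$-tree-connected factor $H$ containing $M$ and a factor $F$ having an orientation such that for each vertex $v$, $d^+_F(v)\ge \lfloor \frac{d_G(v)}{2}\rfloor-m$. Furthermore, for an arbitrary given vertex $u$, this can be done so that in addition $d^+_F(u)\ge\lceil \frac{d_G(u)}{2}\rceil$.
   Context: Graphs are finite, loopless, and may have multiple edges. A factor is a spanning subgraph; a graph is $m$-tree-connected if it contains $m$ pairwise edge-disjoint spanning trees. $d^+_F(v)$ is the out-degree of $v$ in the oriented $F$. *)

theory Defs
  imports Complex_Main "Graph_Theory.Digraph"
begin

text \<open>
  Undirected multigraphs: edges are abstract names, and parallel edges are distinct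
  names with the same set of ends. The symmetric digraphs of \<^theory>\<open>Graph_Theory.Digraph\<close>
  do not represent an undirected edge as a single object, so they are used here only for
  orientations.
\<close>

record ('v, 'e) mgraph =
  mverts :: "'v set"
  medges :: "'e set"
  mends :: "'e \<Rightarrow> 'v set"

definition multigraph :: "('v, 'e) mgraph \<Rightarrow> bool" where
  "multigraph G \<longleftrightarrow> finite (mverts G) \<and> finite (medges G) \<and>
     (\<forall>e\<in>medges G. mends G e \<subseteq> mverts G \<and> card (mends G e) = 2)"

definition mdegree :: "('v, 'e) mgraph \<Rightarrow> 'v \<Rightarrow> nat" where
  "mdegree G v = card {e \<in> medges G. v \<in> mends G e}"

text \<open>Only meaningful if the vertex set is finite and nonempty.\<close>

definition max_degree :: "('v, 'e) mgraph \<Rightarrow> nat" where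
  "max_degree G = Max (mdegree G ` mverts G)"

definition factor_of :: "('v, 'e) mgraph \<Rightarrow> ('v, 'e) mgraph \<Rightarrow> bool" where
  "factor_of H G \<longleftrightarrow> multigraph H \<and> mverts H = mverts G \<and> medges H \<subseteq> medges G \<and>
     (\<forall>e\<in>medges H. mends H e = mends G e)"

definition adj_rel :: "('v, 'e) mgraph \<Rightarrow> ('v \<times> 'v) set" where
  "adj_rel G = {(x, y). \<exists>e\<in>medges G. mends G e = {x, y}}"

text \<open>The graph without vertices is not connected; a graph with one vertex is.\<close>

definition mconnected :: "('v, 'e) mgraph \<Rightarrow> bool" where
  "mconnected G \<longleftrightarrow> mverts G \<noteq> {} \<and> (\<forall>x\<in>mverts G. \<forall>y\<in>mverts G. (x, y) \<in> (adj_rel G)\<^sup>*)"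

definition delete_edges :: "('v, 'e) mgraph \<Rightarrow> 'e set \<Rightarrow> ('v, 'e) mgraph" where
  "delete_edges G S = G\<lparr>medges := medges G - S\<rparr>"

text \<open>
  Under this convention the one-vertex graph is \<open>k\<close>-edge-connected for every \<open>k\<close>.
\<close>

definition edge_connected :: "nat \<Rightarrow> ('v, 'e) mgraph \<Rightarrow> bool" where
  "edge_connected k G \<longleftrightarrow>
     (\<forall>S. S \<subseteq> medges G \<and> card S < k \<longrightarrow> mconnected (delete_edges G S))"

text \<open>
  A cycle runs through the distinct vertices \<open>vs\<close> in cyclic order, using the distinct edges
  \<open>es\<close>. Two parallel edges form a cycle of length 2.
\<close>

definition is_cycle :: "('v, 'e) mgraph \<Rightarrow> 'v list \<Rightarrow> 'e list \<Rightarrow> bool" where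
  "is_cycle G vs es \<longleftrightarrow> length vs = length es \<and> 2 \<le> length es \<and> distinct vs \<and> distinct es \<and>
     set vs \<subseteq> mverts G \<and> set es \<subseteq> medges G \<and>
     (\<forall>i<length es. mends G (es ! i) = {vs ! i, vs ! (Suc i mod length vs)})"

definition is_tree :: "('v, 'e) mgraph \<Rightarrow> bool" where
  "is_tree T \<longleftrightarrow> multigraph T \<and> mconnected T \<and> (\<nexists>vs es. is_cycle T vs es)"

text \<open>
  The trees are indexed rather than collected in a set, because in the one-vertex graph the
  required edge-disjoint spanning trees all coincide.
\<close>

definition tree_connected :: "nat \<Rightarrow> ('v, 'e) mgraph \<Rightarrow> bool" where
  "tree_connected m G \<longleftrightarrow>
     (\<exists>T :: nat \<Rightarrow> ('v, 'e) mgraph.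
        (\<forall>i<m. factor_of (T i) G \<and> is_tree (T i)) \<and>
        (\<forall>i<m. \<forall>j<m. i \<noteq> j \<longrightarrow> medges (T i) \<inter> medges (T j) = {}))"

definition decomposes :: "('v, 'e) mgraph \<Rightarrow> ('v, 'e) mgraph \<Rightarrow> ('v, 'e) mgraph \<Rightarrow> bool" where
  "decomposes G H F \<longleftrightarrow> factor_of H G \<and> factor_of F G \<and>
     medges H \<union> medges F = medges G \<and> medges H \<inter> medges F = {}"

definition orientation_of :: "('v, 'e) pre_digraph \<Rightarrow> ('v, 'e) mgraph \<Rightarrow> bool" where
  "orientation_of D F \<longleftrightarrow> verts D = mverts F \<and> arcs D = medges F \<and>
     (\<forall>e\<in>medges F. {tail D e, head D e} = mends F e)"

end

theory Submission
  imports Defs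
begin

text \<open>
  Put \<open>l v = \<lfloor>d(v)/2\<rfloor> - m\<close> for \<open>v \<noteq> u\<close> and \<open>l u = \<lceil>d(u)/2\<rceil>\<close>. It suffices to find \<open>m\<close> spanning trees
  and, for each vertex \<open>v\<close>, a star of \<open>l v\<close> edges at \<open>v\<close> outside \<open>M\<close>, all pairwise edge-disjoint:
  \<open>F\<close> is the union of the stars, each edge oriented away from the centre of its star, and \<open>H\<close> is
  the rest. These are bases of a matroid union, of \<open>m\<close> copies of the graphic matroid and one
  truncated free matroid per vertex, so they exist if a rank inequality holds for every edge
  set \<open>A\<close>. Let \<open>P\<close> be the partition into the components of \<open>A\<close> and let \<open>X\<close> be the set of the
  vertices with less than \<open>l v\<close> available edges in \<open>A\<close>. The inequality splits into one
  inequality per part \<open>C\<close> of \<open>P\<close>, proved from the cut bounds \<open>d(C) \<ge> 2m\<close> and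
  \<open>d(C - {v}) \<ge> 2m\<close> according to whether \<open>C\<close> meets \<open>X\<close> in none, one, or more vertices. The
  excess of \<open>l u\<close> is paid for by the slack \<open>m\<close> in \<open>m (|P| - 1)\<close> together with integrality.
\<close>

section \<open>Matroid intersection and union\<close>

definition matroid_rank :: "'a set \<Rightarrow> ('a set \<Rightarrow> nat) \<Rightarrow> bool" where
  "matroid_rank E r \<longleftrightarrow> (\<forall>A\<subseteq>E. r A \<le> card A) \<and> (\<forall>A B. A \<subseteq> B \<longrightarrow> B \<subseteq> E \<longrightarrow> r A \<le> r B) \<and>
     (\<forall>A B. A \<subseteq> E \<longrightarrow> B \<subseteq> E \<longrightarrow> r (A \<union> B) + r (A \<inter> B) \<le> r A + r B)"

lemma matroid_rankI:
  assumes "\<And>A. A \<subseteq> E \<Longrightarrow> r A \<le> card A"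
    and "\<And>A B. A \<subseteq> B \<Longrightarrow> B \<subseteq> E \<Longrightarrow> r A \<le> r B"
    and "\<And>A B. A \<subseteq> E \<Longrightarrow> B \<subseteq> E \<Longrightarrow> r (A \<union> B) + r (A \<inter> B) \<le> r A + r B"
  shows "matroid_rank E r"
  using assms by (simp add: matroid_rank_def)

lemma matroid_rank_le_card: "matroid_rank E r \<Longrightarrow> A \<subseteq> E \<Longrightarrow> r A \<le> card A"
  by (simp add: matroid_rank_def)

lemma matroid_rank_mono: "matroid_rank E r \<Longrightarrow> A \<subseteq> B \<Longrightarrow> B \<subseteq> E \<Longrightarrow> r A \<le> r B"
  by (simp add: matroid_rank_def)

lemma matroid_rank_submodular:
  "matroid_rank E r \<Longrightarrow> A \<subseteq> E \<Longrightarrow> B \<subseteq> E \<Longrightarrow> r (A \<union> B) + r (A \<inter> B) \<le> r A + r B"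
  by (simp add: matroid_rank_def)

lemma matroid_rank_subset: "matroid_rank E r \<Longrightarrow> D \<subseteq> E \<Longrightarrow> matroid_rank D r"
  unfolding matroid_rank_def by (meson subset_trans)

lemma matroid_rank_insert_le:
  assumes "matroid_rank E r" "A \<subseteq> E" "e \<in> E"
  shows "r (insert e A) \<le> r A + r {e}"
  using matroid_rank_submodular[OF assms(1), of A "{e}"] assms(2,3) by simp

text \<open>Contraction of a non-loop \<open>e\<close>, the subtracted 1 being \<open>r {e}\<close>.
  Every \<open>r (insert e C)\<close> is at least 1, so the natural-number subtraction never
  truncates and submodularity is inherited.\<close>

lemma matroid_rank_contract:
  assumes r: "matroid_rank E r" and e: "e \<in> E" and re: "r {e} = 1"
  shows "matroid_rank (E - {e}) (\<lambda>A. r (insert e A) - 1)"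
proof (rule matroid_rankI)
  fix A assume A: "A \<subseteq> E - {e}"
  then have "r (insert e A) \<le> r A + 1"
    using matroid_rank_insert_le[OF r _ e, of A] re by auto
  moreover have "r A \<le> card A"
    using A by (intro matroid_rank_le_card[OF r]) auto
  ultimately show "r (insert e A) - 1 \<le> card A" by simp
next
  fix A B assume "A \<subseteq> B" "B \<subseteq> E - {e}"
  then have "r (insert e A) \<le> r (insert e B)"
    using e by (intro matroid_rank_mono[OF r]) auto
  then show "r (insert e A) - 1 \<le> r (insert e B) - 1" by simp
next
  fix A B assume A: "A \<subseteq> E - {e}" and B: "B \<subseteq> E - {e}"
  have ge: "1 \<le> r (insert e C)" if "C \<subseteq> E - {e}" for C
    using matroid_rank_mono[OF r, of "{e}" "insert e C"] that e re by auto
  have "r (insert e A \<union> insert e B) + r (insert e A \<inter> insert e B) \<le> r (insert e A) + r (insert e B)"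
    using A B e by (intro matroid_rank_submodular[OF r]) auto
  moreover have "insert e A \<union> insert e B = insert e (A \<union> B)" 
    "insert e A \<inter> insert e B = insert e (A \<inter> B)" by auto
  ultimately show "r (insert e (A \<union> B)) - 1 + (r (insert e (A \<inter> B)) - 1)
      \<le> r (insert e A) - 1 + (r (insert e B) - 1)"
    using ge[OF A] ge[OF B] ge[of "A \<union> B"] ge[of "A \<inter> B"] A B
    by (simp add: le_infI1)
qed

text \<open>The hard direction of Edmonds' min-max theorem, by induction on the ground set. For any
  element \<open>e\<close>, either the bound survives deleting \<open>e\<close>, or a violating set
  shows that it survives contracting \<open>e\<close>, with \<open>k - 1\<close> for
  \<open>k\<close>.\<close>

theorem matroid_intersection:
  assumes "finite E" "matroid_rank E r1" "matroid_rank E r2"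
    and "\<And>A. A \<subseteq> E \<Longrightarrow> k \<le> r1 A + r2 (E - A)"
  shows "\<exists>I\<subseteq>E. card I = k \<and> r1 I = k \<and> r2 I = k"
  using assms
proof (induction E arbitrary: r1 r2 k rule: finite_psubset_induct)
  case (psubset E)
  note r1 = psubset.prems(1) and r2 = psubset.prems(2) and k = psubset.prems(3)
  have empty: "r1 {} = 0" "r2 {} = 0"
    using matroid_rank_le_card[OF r1, of "{}"] matroid_rank_le_card[OF r2, of "{}"] by auto
  show ?case
  proof (cases "k = 0 \<or> E = {}")
    case True
    then have "k = 0" using k[of "{}"] empty by auto
    then show ?thesis using empty by (intro exI[of _ "{}"]) auto
  next
    case False
    then obtain e where e: "e \<in> E" and kpos: "k > 0" by auto
    show ?thesis
    proof (cases "\<forall>A\<subseteq>E - {e}. k \<le> r1 A + r2 (E - {e} - A)")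
      case True
      then have "\<exists>I\<subseteq>E - {e}. card I = k \<and> r1 I = k \<and> r2 I = k"
        using e r1 r2 by (intro psubset.IH) (auto intro: matroid_rank_subset)
      then show ?thesis by blast
    next
      case False
      then obtain A where A: "A \<subseteq> E - {e}" and Alt: "r1 A + r2 (E - {e} - A) < k" by auto
      \<comment> \<open>Deleting \<open>e\<close> fails because of \<open>A\<close>; submodularity then shows that contracting \<open>e\<close> works.\<close>
      have eqs: "E - {e} - A = E - insert e A" "insert e (E - insert e A) = E - A" using e A by auto
      have sub: "A \<subseteq> E" "insert e A \<subseteq> E" using A e by auto
      have "r1 (insert e A) \<le> r1 A + r1 {e}" "r2 (E - A) \<le> r2 (E - {e} - A) + r2 {e}"
        using matroid_rank_insert_le[OF r1 sub(1) e] matroid_rank_insert_le[OF r2 _ e, of "E - {e} - A"]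
        by (auto simp: eqs)
      moreover have "k \<le> r1 (insert e A) + r2 (E - {e} - A)" "k \<le> r1 A + r2 (E - A)"
        using k[OF sub(1)] k[OF sub(2)] by (simp_all add: eqs)
      \<comment> \<open>If \<open>e\<close> were a loop of the first matroid, the bound would fail
        at \<open>insert e A\<close>; if it were a loop of the second, at \<open>A\<close>.\<close>
      ultimately have "r1 {e} \<noteq> 0" "r2 {e} \<noteq> 0" using Alt by linarith+
      moreover have "r1 {e} \<le> 1" "r2 {e} \<le> 1"
        using matroid_rank_le_card[OF r1, of "{e}"] matroid_rank_le_card[OF r2, of "{e}"] e by simp_all
      ultimately have re: "r1 {e} = 1" "r2 {e} = 1" by linarith+
      have pos: "1 \<le> r1 (insert e B)" "1 \<le> r2 (insert e B)" if "B \<subseteq> E" for B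
        using matroid_rank_mono[OF r1, of "{e}" "insert e B"]
          matroid_rank_mono[OF r2, of "{e}" "insert e B"] that e re by auto
      have "k - 1 \<le> (r1 (insert e B) - 1) + (r2 (insert e (E - {e} - B)) - 1)"
        if B: "B \<subseteq> E - {e}" for B
      proof -
        \<comment> \<open>Uncrossing: the union and the intersection of \<open>A\<close> and
          \<open>insert e B\<close> both obey the bound, while \<open>A\<close> accounts for at most
          \<open>k - 1\<close>. So \<open>r1 (insert e B) + r2 (E - B)\<close> is at least
          \<open>k + 1\<close>, which pays for both subtracted units.\<close>
        have "r1 (A \<union> insert e B) + r1 (A \<inter> insert e B) \<le> r1 A + r1 (insert e B)"
          using A B e by (intro matroid_rank_submodular[OF r1]) auto
        moreover have "r2 ((E - {e} - A) \<union> (E - B)) + r2 ((E - {e} - A) \<inter> (E - B))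
            \<le> r2 (E - {e} - A) + r2 (E - B)"
          by (intro matroid_rank_submodular[OF r2]) auto
        moreover have "A \<inter> insert e B = A \<inter> B" "(E - {e} - A) \<union> (E - B) = E - (A \<inter> B)"
          "(E - {e} - A) \<inter> (E - B) = E - (A \<union> insert e B)" "insert e (E - {e} - B) = E - B"
          using A B e by auto
        moreover have "k \<le> r1 (A \<inter> B) + r2 (E - (A \<inter> B))" using A by (intro k) auto
        moreover have "k \<le> r1 (A \<union> insert e B) + r2 (E - (A \<union> insert e B))"
          using A B e by (intro k) auto
        moreover have "1 \<le> r1 (insert e B)" "1 \<le> r2 (insert e (E - {e} - B))"
          using B by (intro pos; blast)+
        ultimately show ?thesis using Alt by simp
      qed
      then have "\<exists>I\<subseteq>E - {e}. card I = k - 1 \<and> r1 (insert e I) - 1 = k - 1 \<and> r2 (insert e I) - 1 = k - 1"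
        using e re r1 r2 by (intro psubset.IH matroid_rank_contract) auto
      then obtain I where I: "I \<subseteq> E - {e}" "card I = k - 1" "r1 (insert e I) - 1 = k - 1"
        "r2 (insert e I) - 1 = k - 1" by blast
      have "finite I" "e \<notin> I" "I \<subseteq> E" using I(1) psubset.hyps by (auto dest: finite_subset)
      moreover have "r1 (insert e I) = k" "r2 (insert e I) = k"
        using pos[OF \<open>I \<subseteq> E\<close>] I kpos by linarith+
      ultimately show ?thesis using I kpos e by (intro exI[of _ "insert e I"]) auto
    qed
  qed
qed

lemma card_eq_sum_fibres:
  assumes "finite J" "finite A" "A \<subseteq> E \<times> J"
  shows "card A = (\<Sum>j\<in>J. card {e. (e, j) \<in> A})"
proof -
  have "finite {e. (e, j) \<in> A}" for j
    by (rule finite_subset[of _ "fst ` A"]) (use assms(2) in force)+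
  then have "(\<Sum>j\<in>J. card {e. (e, j) \<in> A}) = card (SIGMA j:J. {e. (e, j) \<in> A})"
    using assms(1) by simp
  also have "(SIGMA j:J. {e. (e, j) \<in> A}) = prod.swap ` A"
    using assms(3) by (force simp: prod.swap_def)
  also have "card (prod.swap ` A) = card A"
    by (rule card_image) simp
  finally show ?thesis by simp
qed

text \<open>
  A disjoint choice of sets is a common independent set, on \<open>E \<times> J\<close>, of the direct sum of the
  matroids and of the partition matroid given by the first projection.
\<close>

theorem matroid_union:
  fixes r :: "'i \<Rightarrow> 'e set \<Rightarrow> nat"
  assumes E: "finite E" and J: "finite J" and r: "\<And>j. j \<in> J \<Longrightarrow> matroid_rank E (r j)"
    and k: "\<And>A. A \<subseteq> E \<Longrightarrow> (\<Sum>j\<in>J. r j E) \<le> (\<Sum>j\<in>J. r j A) + card (E - A)"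
  obtains I where "\<And>j. j \<in> J \<Longrightarrow> I j \<subseteq> E" "\<And>j. j \<in> J \<Longrightarrow> card (I j) = r j E"
    "\<And>j. j \<in> J \<Longrightarrow> r j (I j) = r j E"
    "\<And>i j. i \<in> J \<Longrightarrow> j \<in> J \<Longrightarrow> i \<noteq> j \<Longrightarrow> I i \<inter> I j = {}"
proof -
  define fib where "fib = (\<lambda>(A :: ('e \<times> 'i) set) j. {e. (e, j) \<in> A})"
  define k where "k = (\<Sum>j\<in>J. r j E)"
  have fib: "fib A j \<subseteq> E" if "A \<subseteq> E \<times> J" for A j
    using that by (auto simp: fib_def)
  have fin: "finite A" if "A \<subseteq> E \<times> J" for A
    using that E J finite_subset by blast
  have rank1: "matroid_rank (E \<times> J) (\<lambda>A. \<Sum>j\<in>J. r j (fib A j))"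
  proof (rule matroid_rankI)
    fix A assume A: "A \<subseteq> E \<times> J"
    have "(\<Sum>j\<in>J. r j (fib A j)) \<le> (\<Sum>j\<in>J. card (fib A j))"
      using r fib[OF A] by (intro sum_mono matroid_rank_le_card[of E]) auto
    also have "\<dots> = card A" using card_eq_sum_fibres[OF J fin[OF A] A] by (simp add: fib_def)
    finally show "(\<Sum>j\<in>J. r j (fib A j)) \<le> card A" .
  next
    fix A B assume "A \<subseteq> B" "B \<subseteq> E \<times> J"
    then show "(\<Sum>j\<in>J. r j (fib A j)) \<le> (\<Sum>j\<in>J. r j (fib B j))"
      using r by (intro sum_mono matroid_rank_mono[of E]) (auto simp: fib_def)
  next
    fix A B assume "A \<subseteq> E \<times> J" "B \<subseteq> E \<times> J"
    then have "r j (fib A j \<union> fib B j) + r j (fib A j \<inter> fib B j) \<le> r j (fib A j) + r j (fib B j)"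
      if "j \<in> J" for j
      using that r fib by (intro matroid_rank_submodular[of E]) auto
    moreover have "fib (A \<union> B) j = fib A j \<union> fib B j" "fib (A \<inter> B) j = fib A j \<inter> fib B j" for j
      by (auto simp: fib_def)
    ultimately show "(\<Sum>j\<in>J. r j (fib (A \<union> B) j)) + (\<Sum>j\<in>J. r j (fib (A \<inter> B) j))
        \<le> (\<Sum>j\<in>J. r j (fib A j)) + (\<Sum>j\<in>J. r j (fib B j))"
      by (simp add: sum.distrib[symmetric] sum_mono)
  qed
  have rank2: "matroid_rank (E \<times> J) (\<lambda>A. card (fst ` A))"
  proof (rule matroid_rankI)
    fix A assume "A \<subseteq> E \<times> J"
    then show "card (fst ` A) \<le> card A" by (intro card_image_le fin)
  next
    fix A B assume "A \<subseteq> B" "B \<subseteq> E \<times> J"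
    then show "card (fst ` A) \<le> card (fst ` B)" by (intro card_mono finite_imageI fin image_mono)
  next
    fix A B assume AB: "A \<subseteq> E \<times> J" "B \<subseteq> E \<times> J"
    have "card (fst ` (A \<inter> B)) \<le> card (fst ` A \<inter> fst ` B)"
      using fin AB by (intro card_mono) auto
    then show "card (fst ` (A \<union> B)) + card (fst ` (A \<inter> B)) \<le> card (fst ` A) + card (fst ` B)"
      using card_Un_Int[of "fst ` A" "fst ` B"] fin AB by (simp add: image_Un)
  qed
  have "k \<le> (\<Sum>j\<in>J. r j (fib A j)) + card (fst ` (E \<times> J - A))" if A: "A \<subseteq> E \<times> J" for A
  proof -
    \<comment> \<open>\<open>B\<close> consists of the elements all of whose copies lie in
      \<open>A\<close>. It is contained in every fibre of \<open>A\<close>, and its complement is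
      the projection of the complement of \<open>A\<close>.\<close>
    define B where "B = E - fst ` (E \<times> J - A)"
    have "(\<Sum>j\<in>J. r j B) \<le> (\<Sum>j\<in>J. r j (fib A j))"
      using r fib[OF A] by (intro sum_mono matroid_rank_mono[of E]) (force simp: B_def fib_def)+
    moreover have "E - B = fst ` (E \<times> J - A)" by (auto simp: B_def)
    ultimately show ?thesis using k[of B] by (auto simp: k_def B_def)
  qed
  from matroid_intersection[OF _ rank1 rank2 this] E J
  obtain I where I: "I \<subseteq> E \<times> J" "card I = k" "(\<Sum>j\<in>J. r j (fib I j)) = k" "card (fst ` I) = k"
    by auto
  have le: "r j (fib I j) \<le> r j E" "r j (fib I j) \<le> card (fib I j)" if "j \<in> J" for j
    using matroid_rank_mono[OF r[OF that] fib[OF I(1)]]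
      matroid_rank_le_card[OF r[OF that] fib[OF I(1)]] by auto
  \<comment> \<open>Termwise inequalities between sums with the same total \<open>k\<close> are
    equalities. Used twice, this makes each fibre both of full rank and independent.\<close>
  have eq: "r j (fib I j) = r j E" if "j \<in> J" for j
    using sum_mono_inv[of "\<lambda>j. r j (fib I j)" J "\<lambda>j. r j E" j] le that J I(3) by (simp add: k_def)
  have "(\<Sum>j\<in>J. card (fib I j)) = k"
    using card_eq_sum_fibres[OF J fin[OF I(1)] I(1)] I(2) by (simp add: fib_def)
  then have eq': "r j (fib I j) = card (fib I j)" if "j \<in> J" for j
    using sum_mono_inv[of "\<lambda>j. r j (fib I j)" J "\<lambda>j. card (fib I j)" j] le that J I(3) by simp
  \<comment> \<open>\<open>I\<close> and its projection both have \<open>k\<close> elements, so no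
    element is chosen for two indices.\<close>
  have "inj_on fst I" using I fin by (intro eq_card_imp_inj_on) auto
  then have "fib I i \<inter> fib I j = {}" if "i \<noteq> j" for i j
    using that unfolding fib_def inj_on_def disjoint_iff mem_Collect_eq by (metis fst_conv snd_conv)
  then show thesis using that[of "fib I"] eq eq' fib[OF I(1)] by simp
qed

text \<open>\<open>P e A\<close> says that \<open>e\<close> lies in the closure of \<open>A\<close>.\<close>

lemma matroid_rank_if_marginals:
  assumes E: "finite E" and zero: "r {} = 0"
    and step: "\<And>A e. A \<subseteq> E \<Longrightarrow> e \<in> E \<Longrightarrow> r (insert e A) = r A + (if P e A then 0 else 1)"
    and mono: "\<And>A B e. A \<subseteq> B \<Longrightarrow> B \<subseteq> E \<Longrightarrow> e \<in> E \<Longrightarrow> P e A \<Longrightarrow> P e B"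
  shows "matroid_rank E r"
proof -
  have le_add_card: "r (A \<union> D) \<le> r A + card D" if "A \<subseteq> E" "D \<subseteq> E" for A D
    using finite_subset[OF that(2) E] that(2)
  proof (induction D rule: finite_induct)
    case (insert e D)
    then show ?case using step[of "A \<union> D" e] that(1) by (auto split: if_splits)
  qed simp
  have ge: "r A \<le> r (A \<union> D)" if "A \<subseteq> E" "D \<subseteq> E" for A D
    using finite_subset[OF that(2) E] that(2)
  proof (induction D rule: finite_induct)
    case (insert e D)
    then show ?case using step[of "A \<union> D" e] that(1) by (auto split: if_splits)
  qed simp
  \<comment> \<open>Diminishing returns: adjoining \<open>D\<close> to the larger set gains no more
    than adjoining it to the smaller one. Submodularity is the case of the sets
    \<open>A \<inter> B\<close> and \<open>A\<close>, with \<open>B\<close> adjoined.\<close>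
  have diminishing: "r (B \<union> D) + r A \<le> r (A \<union> D) + r B" if "A \<subseteq> B" "B \<subseteq> E" "D \<subseteq> E" for A B D
    using finite_subset[OF that(3) E] that(3)
  proof (induction D rule: finite_induct)
    case (insert e D)
    have "A \<union> D \<subseteq> B \<union> D" "B \<union> D \<subseteq> E" "A \<union> D \<subseteq> E" "e \<in> E" using that insert by auto
    then have "P e (A \<union> D) \<Longrightarrow> P e (B \<union> D)"
      and "r (insert e (A \<union> D)) = r (A \<union> D) + (if P e (A \<union> D) then 0 else 1)"
      and "r (insert e (B \<union> D)) = r (B \<union> D) + (if P e (B \<union> D) then 0 else 1)"
      by (simp_all add: step mono[of "A \<union> D" "B \<union> D" e])
    then show ?case using insert by (auto split: if_splits)
  qed simp
  show ?thesis
  proof (rule matroid_rankI)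
    fix A assume "A \<subseteq> E"
    then show "r A \<le> card A" using le_add_card[of "{}" A] zero by simp
  next
    fix A B assume "A \<subseteq> B" "B \<subseteq> E"
    then show "r A \<le> r B" using ge[of A B] by (simp add: Un_absorb1)
  next
    fix A B assume AB: "A \<subseteq> E" "B \<subseteq> E"
    then have "r (A \<union> B) + r (A \<inter> B) \<le> r ((A \<inter> B) \<union> B) + r A"
      by (intro diminishing) auto
    then show "r (A \<union> B) + r (A \<inter> B) \<le> r A + r B" by (simp add: Un_absorb1)
  qed
qed

section \<open>The graphic matroid\<close>

text \<open>The reflexive transitive closure relates every element of the type to itself; the
  restriction to the vertices makes this an equivalence relation on \<open>mverts G\<close>, as the
  quotient below requires.\<close>

definition connection :: "('v, 'e) mgraph \<Rightarrow> 'e set \<Rightarrow> ('v \<times> 'v) set" where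
  "connection G A = {(x, y). x \<in> mverts G \<and> y \<in> mverts G \<and> (x, y) \<in> (adj_rel (G\<lparr>medges := A\<rparr>))\<^sup>*}"

definition components :: "('v, 'e) mgraph \<Rightarrow> 'e set \<Rightarrow> 'v set set" where
  "components G A = mverts G // connection G A"

text \<open>The number of edges of a spanning forest of the graph with edge set
  \<open>A\<close>.\<close>

definition graph_rank :: "('v, 'e) mgraph \<Rightarrow> 'e set \<Rightarrow> nat" where
  "graph_rank G A = card (mverts G) - card (components G A)"

lemma multigraph_ends:
  assumes "multigraph G" "e \<in> medges G"
  obtains x y where "mends G e = {x, y}" "x \<noteq> y" "x \<in> mverts G" "y \<in> mverts G"
  using assms unfolding multigraph_def card_2_iff by (metis insert_subset)

lemma adj_rel_mono: "A \<subseteq> B \<Longrightarrow> adj_rel (G\<lparr>medges := A\<rparr>) \<subseteq> adj_rel (G\<lparr>medges := B\<rparr>)"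
  by (auto simp: adj_rel_def)

lemma sym_adj_rel: "sym (adj_rel G)"
  by (auto simp: adj_rel_def sym_def insert_commute)

lemma connection_mono: "A \<subseteq> B \<Longrightarrow> connection G A \<subseteq> connection G B"
  using rtrancl_mono[OF adj_rel_mono[of A B G]] by (auto simp: connection_def)

lemma equiv_connection: "equiv (mverts G) (connection G A)"
proof (rule equivI)
  show "connection G A \<subseteq> mverts G \<times> mverts G" by (auto simp: connection_def)
  show "refl_on (mverts G) (connection G A)" by (auto simp: connection_def refl_on_def)
  show "sym (connection G A)"
    by (rule symI) (auto simp: connection_def dest: symD[OF sym_rtrancl[OF sym_adj_rel]])
  show "trans (connection G A)"
    by (rule transI) (auto simp: connection_def intro: rtrancl_trans)
qed

lemma connection_edge:
  assumes "multigraph G" "e \<in> A" "A \<subseteq> medges G" "x \<in> mends G e" "y \<in> mends G e"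
  shows "(x, y) \<in> connection G A"
proof -
  have "e \<in> medges G" using assms by auto
  then obtain a b where ab: "mends G e = {a, b}" "a \<in> mverts G" "b \<in> mverts G"
    using multigraph_ends[OF assms(1)] by metis
  then have "(a, b) \<in> adj_rel (G\<lparr>medges := A\<rparr>)" "(b, a) \<in> adj_rel (G\<lparr>medges := A\<rparr>)"
    using assms(2) by (auto simp: adj_rel_def insert_commute)
  then show ?thesis using ab assms(4,5) by (auto simp: connection_def)
qed

text \<open>The new edge adds two pairs to the adjacency relation, one per direction. A walk using
  both directions can be shortened by symmetry, so at most one crossing has to be recorded.\<close>

lemma connection_insert:
  assumes e: "mends G e = {x, y}" and "x \<in> mverts G" "y \<in> mverts G"
  shows "(a, b) \<in> connection G (insert e A) \<longleftrightarrow> (a, b) \<in> connection G A \<or>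
    (a, x) \<in> connection G A \<and> (y, b) \<in> connection G A \<or>
    (a, y) \<in> connection G A \<and> (x, b) \<in> connection G A"
proof -
  define R where "R = adj_rel (G\<lparr>medges := A\<rparr>)"
  have "adj_rel (G\<lparr>medges := insert e A\<rparr>) = insert (x, y) (insert (y, x) R)"
    using e by (auto simp: adj_rel_def R_def doubleton_eq_iff insert_commute)
  moreover have "sym (R\<^sup>*)" unfolding R_def by (intro sym_rtrancl sym_adj_rel)
  then have "(x, y) \<in> R\<^sup>* \<longleftrightarrow> (y, x) \<in> R\<^sup>*" by (auto dest: symD)
  ultimately have "(a, b) \<in> (adj_rel (G\<lparr>medges := insert e A\<rparr>))\<^sup>* \<longleftrightarrow> (a, b) \<in> R\<^sup>* \<or>
      (a, x) \<in> R\<^sup>* \<and> (y, b) \<in> R\<^sup>* \<or> (a, y) \<in> R\<^sup>* \<and> (x, b) \<in> R\<^sup>*"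
    by (auto simp: rtrancl_insert intro: rtrancl_trans)
  then show ?thesis using assms by (auto simp: connection_def R_def)
qed

lemma components_subset: "C \<in> components G A \<Longrightarrow> C \<subseteq> mverts G"
  unfolding components_def by (rule in_quotient_imp_subset[OF equiv_connection])

lemma finite_components: "finite (mverts G) \<Longrightarrow> finite (components G A)"
  by (simp add: components_def quotient_def)

lemma card_components_le: "finite (mverts G) \<Longrightarrow> card (components G A) \<le> card (mverts G)"
  using card_image_le[of "mverts G" "\<lambda>x. connection G A `` {x}"]
  by (simp add: components_def quotient_def UNION_singleton_eq_range)

lemma card_components_pos: "finite (mverts G) \<Longrightarrow> mverts G \<noteq> {} \<Longrightarrow> 1 \<le> card (components G A)"
  using finite_components[of G A] by (auto simp: components_def Suc_le_eq card_gt_0_iff)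

lemma components_insert:
  assumes e: "mends G e = {x, y}" and x: "x \<in> mverts G" and y: "y \<in> mverts G"
    and nc: "(x, y) \<notin> connection G A"
  defines "cls \<equiv> \<lambda>a. connection G A `` {a}"
  shows "components G (insert e A) = insert (cls x \<union> cls y) (components G A - {cls x, cls y})"
proof -
  note eqv = equiv_connection[of G A]
  note ins = connection_insert[OF e x y]
  have symm: "(a, b) \<in> connection G A \<longleftrightarrow> (b, a) \<in> connection G A" for a b
    using eqv by (meson equivE symD)
  have cls: "cls a = cls b \<longleftrightarrow> (a, b) \<in> connection G A" if "a \<in> mverts G" "b \<in> mverts G" for a b
    using eq_equiv_class_iff[OF eqv that] by (simp add: cls_def)
  have tr: "(a, b) \<in> connection G A \<Longrightarrow> (b, c) \<in> connection G A \<Longrightarrow> (a, c) \<in> connection G A" for a b c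
    using eqv by (meson equivE transD)
  have new: "connection G (insert e A) `` {a} = (if cls a = cls x \<or> cls a = cls y then cls x \<union> cls y else cls a)"
    if a: "a \<in> mverts G" for a
  proof (cases "cls a = cls x \<or> cls a = cls y")
    case True
    then have "(a, x) \<in> connection G A \<or> (a, y) \<in> connection G A" using cls a x y by blast
    then have "(a, b) \<in> connection G (insert e A) \<longleftrightarrow> (x, b) \<in> connection G A \<or> (y, b) \<in> connection G A" for b
      unfolding ins using tr symm by meson
    then show ?thesis using True by (auto simp: cls_def)
  next
    case False
    then have "(a, x) \<notin> connection G A" "(a, y) \<notin> connection G A" using cls a x y by blast+
    then show ?thesis using False by (auto simp: cls_def ins)
  qed
  have "components G (insert e A) = (\<lambda>a. connection G (insert e A) `` {a}) ` mverts G"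
    by (auto simp: components_def quotient_def)
  also have "\<dots> = (\<lambda>a. if cls a = cls x \<or> cls a = cls y then cls x \<union> cls y else cls a) ` mverts G"
    by (intro image_cong) (simp_all add: new)
  also have "\<dots> = insert (cls x \<union> cls y) (cls ` mverts G - {cls x, cls y})"
    using x y by auto
  also have "cls ` mverts G = components G A" by (auto simp: components_def quotient_def cls_def)
  finally show ?thesis .
qed

text \<open>An edge inside a part leaves the partition unchanged; an edge between two parts merges
  them, which lowers the number of parts by exactly one.\<close>

lemma graph_rank_insert:
  assumes G: "multigraph G" and e: "mends G e = {x, y}" and x: "x \<in> mverts G" and y: "y \<in> mverts G"
  shows "graph_rank G (insert e A) = graph_rank G A + (if (x, y) \<in> connection G A then 0 else 1)"
proof (cases "(x, y) \<in> connection G A")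
  case True
  note eqv = equiv_connection[of G A]
  have "(y, x) \<in> connection G A" using True eqv by (meson equivE symD)
  then have "connection G (insert e A) = connection G A"
    using True eqv connection_insert[OF e x y, of _ _ A] 
    by (intro subset_antisym subrelI) (meson equivE transD)+
  then show ?thesis using True by (simp add: graph_rank_def components_def)
next
  case False
  have fin: "finite (mverts G)" using G by (simp add: multigraph_def)
  let ?c = "\<lambda>a. connection G A `` {a}"
  note eqv = equiv_connection[of G A]
  have ne: "?c x \<noteq> ?c y" using eq_equiv_class_iff[OF eqv x y] False by simp
  have mem: "?c x \<in> components G A" "?c y \<in> components G A"
    using x y by (auto simp: components_def quotient_def)
  have self: "x \<in> ?c x" "y \<in> ?c y" using x y by (auto simp: connection_def)
  \<comment> \<open>Needed for the count: two parts disappear, and the merged part must be a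
    genuinely new one.\<close>
  have "?c x \<union> ?c y \<notin> components G A"
  proof
    assume m: "?c x \<union> ?c y \<in> components G A"
    have "?c x \<union> ?c y = ?c x" "?c x \<union> ?c y = ?c y"
      using quotient_disj[OF eqv, of "?c x \<union> ?c y" "?c x"] quotient_disj[OF eqv, of "?c x \<union> ?c y" "?c y"]
        m mem self unfolding components_def by blast+
    then show False using ne by simp
  qed
  then have "card (components G (insert e A)) = Suc (card (components G A - {?c x, ?c y}))"
    using finite_components[OF fin] by (subst components_insert[OF e x y False]) simp
  moreover have "card (components G A - {?c x, ?c y}) = card (components G A) - 2"
    using ne mem finite_components[OF fin] by (subst card_Diff_subset) auto
  moreover have "2 \<le> card (components G A)"
    using card_mono[OF finite_components[OF fin], of "{?c x, ?c y}" A] ne mem by simp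
  ultimately show ?thesis using False card_components_le[OF fin, of A] by (simp add: graph_rank_def)
qed

text \<open>An edge is in the closure of \<open>A\<close> iff its ends are connected in
  \<open>A\<close>, and this persists as \<open>A\<close> grows. The product of the end set with
  itself expresses it without naming the two ends.\<close>

lemma matroid_rank_graph_rank:
  assumes G: "multigraph G"
  shows "matroid_rank (medges G) (graph_rank G)"
proof (rule matroid_rank_if_marginals[where P = "\<lambda>e A. mends G e \<times> mends G e \<subseteq> connection G A"])
  show "finite (medges G)" using G by (simp add: multigraph_def)
  have "adj_rel (G\<lparr>medges := {}\<rparr>) = {}" by (auto simp: adj_rel_def)
  then have "connection G {} = Id_on (mverts G)" by (auto simp: connection_def)
  then have "components G {} = (\<lambda>x. {x}) ` mverts G" by (auto simp: components_def quotient_def)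
  then show "graph_rank G {} = 0" by (simp add: graph_rank_def card_image)
next
  fix A e assume "A \<subseteq> medges G" "e \<in> medges G"
  then obtain x y where e: "mends G e = {x, y}" "x \<in> mverts G" "y \<in> mverts G"
    using multigraph_ends[OF G] by metis
  have "mends G e \<times> mends G e \<subseteq> connection G A \<longleftrightarrow> (x, y) \<in> connection G A"
    using e equiv_connection[of G A] unfolding e(1)
    by (auto simp: connection_def) (meson sym_adj_rel sym_rtrancl symD)
  then show "graph_rank G (insert e A) =
      graph_rank G A + (if mends G e \<times> mends G e \<subseteq> connection G A then 0 else 1)"
    using graph_rank_insert[OF G e] by simp
next
  fix A B e assume "A \<subseteq> B" "mends G e \<times> mends G e \<subseteq> connection G A"
  then show "mends G e \<times> mends G e \<subseteq> connection G B" using connection_mono by blast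
qed

section \<open>Spanning trees as bases of the graphic matroid\<close>

lemma mconnected_iff_card_components:
  assumes "multigraph G" and "mverts G \<noteq> {}"
  shows "mconnected (G\<lparr>medges := A\<rparr>) \<longleftrightarrow> card (components G A) = 1"
proof
  assume "mconnected (G\<lparr>medges := A\<rparr>)"
  then have "connection G A = mverts G \<times> mverts G" by (auto simp: mconnected_def connection_def)
  then have "components G A = {mverts G}" using assms by (auto simp: components_def quotient_def)
  then show "card (components G A) = 1" by simp
next
  assume "card (components G A) = 1"
  then obtain C where C: "components G A = {C}" by (auto simp: card_1_singleton_iff)
  have "(x, y) \<in> connection G A" if "x \<in> mverts G" "y \<in> mverts G" for x y
  proof -
    have "connection G A `` {x} \<in> components G A" "connection G A `` {y} \<in> components G A"
      using that by (auto simp: components_def quotient_def)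
    then show ?thesis using C eq_equiv_class_iff[OF equiv_connection that] by auto
  qed
  then show "mconnected (G\<lparr>medges := A\<rparr>)" using assms by (auto simp: mconnected_def connection_def)
qed

text \<open>The closing edge of a cycle lies in the closure of the other edges, so removing it keeps
  the rank and \<open>A\<close> is not independent.\<close>

lemma no_cycle_if_graph_rank_eq_card:
  assumes G: "multigraph G" and A: "A \<subseteq> medges G" and r: "graph_rank G A = card A"
  shows "\<not> is_cycle (G\<lparr>medges := A\<rparr>) vs es"
proof
  assume cyc: "is_cycle (G\<lparr>medges := A\<rparr>) vs es"
  define k where "k = length es - 1"
  define e where "e = es ! k"
  have len: "length vs = length es" "2 \<le> length es" and dist: "distinct es"
    and vs: "set vs \<subseteq> mverts G" and es: "set es \<subseteq> A"
    and ends: "\<And>i. i < length es \<Longrightarrow> mends G (es ! i) = {vs ! i, vs ! (Suc i mod length vs)}"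
    using cyc by (auto simp: is_cycle_def)
  have k: "k < length es" "Suc k = length es" using len by (auto simp: k_def)
  \<comment> \<open>\<open>k\<close> is the last index, so \<open>Suc k\<close> wraps round to 0 and
    \<open>e\<close> joins the last vertex to the first; the other edges form a path between
    them.\<close>
  have e: "e \<in> A" "mends G e = {vs ! k, vs ! 0}"
    using k es ends[OF k(1)] len by (auto simp: e_def)
  have "(vs ! 0, vs ! i) \<in> (adj_rel (G\<lparr>medges := A - {e}\<rparr>))\<^sup>*" if "i \<le> k" for i
    using that
  proof (induction i)
    case (Suc i)
    then have "es ! i \<noteq> e" "es ! i \<in> A" "mends G (es ! i) = {vs ! i, vs ! Suc i}"
      using k dist es ends[of i] len by (auto simp: e_def nth_eq_iff_index_eq)
    then have "(vs ! i, vs ! Suc i) \<in> adj_rel (G\<lparr>medges := A - {e}\<rparr>)" by (auto simp: adj_rel_def)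
    then show ?case using Suc by (auto intro: rtrancl_into_rtrancl)
  qed simp
  moreover have in_V: "vs ! 0 \<in> mverts G" "vs ! k \<in> mverts G" using k len by (auto intro!: subsetD[OF vs] nth_mem)
  ultimately have "(vs ! 0, vs ! k) \<in> connection G (A - {e})" by (auto simp: connection_def)
  then have "graph_rank G (insert e (A - {e})) = graph_rank G (A - {e})"
    using graph_rank_insert[OF G _ in_V, of e "A - {e}"] e by (simp add: insert_commute)
  also have "\<dots> \<le> card (A - {e})"
    using A by (intro matroid_rank_le_card[OF matroid_rank_graph_rank[OF G]]) auto
  also have "\<dots> < card A"
    using e A G by (intro card_Diff1_less) (auto simp: multigraph_def dest: finite_subset)
  finally show False using r e by (simp add: insert_absorb)
qed

text \<open>Full rank leaves a single component, and independence excludes cycles.\<close>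

lemma spanning_tree_if_graph_rank:
  assumes G: "multigraph G" "mverts G \<noteq> {}" and A: "A \<subseteq> medges G"
    and r: "graph_rank G A = card (mverts G) - 1" "graph_rank G A = card A"
  shows "is_tree (G\<lparr>medges := A\<rparr>)"
proof -
  have fin: "finite (mverts G)" using G by (simp add: multigraph_def)
  have "card (components G A) = 1"
    using r(1) card_components_le[OF fin, of A] card_components_pos[OF fin G(2), of A]
    by (auto simp: graph_rank_def)
  moreover have "multigraph (G\<lparr>medges := A\<rparr>)"
    using G A by (auto simp: multigraph_def dest: finite_subset)
  ultimately show ?thesis
    using no_cycle_if_graph_rank_eq_card[OF G(1) A r(2)] mconnected_iff_card_components[OF G]
    by (auto simp: is_tree_def)
qed

section \<open>Cuts and degrees\<close>

definition cut :: "('v, 'e) mgraph \<Rightarrow> 'v set \<Rightarrow> 'e set" where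
  "cut G C = {e \<in> medges G. mends G e \<inter> C \<noteq> {} \<and> \<not> mends G e \<subseteq> C}"

text \<open>Once the cut is deleted, no walk starting in \<open>C\<close> can leave
  \<open>C\<close>.\<close>

lemma card_cut_ge_if_edge_connected:
  assumes G: "multigraph G" and k: "edge_connected k G" and C: "C \<noteq> {}" "C \<subset> mverts G"
  shows "k \<le> card (cut G C)"
proof (rule ccontr)
  assume "\<not> k \<le> card (cut G C)"
  then have conn: "mconnected (delete_edges G (cut G C))"
    using k by (auto simp: edge_connected_def cut_def)
  from C obtain x y where xy: "x \<in> C" "x \<in> mverts G" "y \<in> mverts G" "y \<notin> C" by auto
  have "(x, y) \<in> (adj_rel (delete_edges G (cut G C)))\<^sup>*"
    using conn xy by (auto simp: mconnected_def delete_edges_def)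
  then have "y \<in> C"
  proof (induction rule: rtrancl_induct)
    case (step a b)
    then obtain e where "e \<in> medges G - cut G C" "mends G e = {a, b}"
      by (auto simp: adj_rel_def delete_edges_def)
    then show ?case using step by (auto simp: cut_def)
  qed (use xy in simp)
  then show False using xy by simp
qed

text \<open>Double counting of incidences. With \<open>f\<close> arbitrary, it serves both for the
  ends of an edge and for the parts that an edge meets.\<close>

lemma sum_card_incident_le:
  assumes "finite X" "finite S" and "\<And>e. e \<in> S \<Longrightarrow> card {v \<in> X. v \<in> f e} \<le> c"
  shows "(\<Sum>v\<in>X. card {e \<in> S. v \<in> f e}) \<le> c * card S"
proof -
  have "(\<Sum>v\<in>X. card {e \<in> S. v \<in> f e}) = (\<Sum>e\<in>S. card {v \<in> X. v \<in> f e})"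
    using assms by (intro sum_multicount_gen) auto
  also have "\<dots> \<le> (\<Sum>e\<in>S. c)" using assms by (intro sum_mono) auto
  finally show ?thesis by (simp add: mult.commute)
qed

text \<open>
  Twice the contribution of a part \<open>C\<close>, with all terms on the side where they are positive;
  \<open>N\<close> will be the set of edges outside \<open>M\<close>.
\<close>

lemma part_degree_bound:
  assumes G: "multigraph G" and k: "edge_connected (2 * m) G"
    and N: "N \<subseteq> medges G" and deg: "\<And>v. v \<in> mverts G \<Longrightarrow> card {e \<in> medges G - N. v \<in> mends G e} \<le> m"
    and C: "C \<noteq> {}" "C \<subseteq> mverts G" and X: "X \<subseteq> C" and nontriv: "C \<noteq> mverts G \<or> X \<noteq> {}"
  shows "(\<Sum>v\<in>X. mdegree G v) + 2 * m
    \<le> card (cut G C) + 2 * card {e \<in> N. mends G e \<subseteq> C \<and> mends G e \<inter> X \<noteq> {}} + 2 * m * card X"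
proof -
  have finE: "finite (medges G)" and finV: "finite (mverts G)" using G by (auto simp: multigraph_def)
  have ends: "finite (mends G e)" "card (mends G e) = 2" if "e \<in> medges G" for e
    using G that finV by (auto simp: multigraph_def dest: finite_subset)
  have finN: "finite N" and finX: "finite X" using N X C finE finV by (auto dest: finite_subset)
  define inner where "inner v = {e \<in> medges G. mends G e \<subseteq> C \<and> v \<in> mends G e}" for v
  define innerN where "innerN v = {e \<in> N. mends G e \<subseteq> C \<and> v \<in> mends G e}" for v
  define out where "out v = {e \<in> cut G C. v \<in> mends G e}" for v
  define T where "T = {e \<in> N. mends G e \<subseteq> C \<and> mends G e \<inter> X \<noteq> {}}"
  have fin: "finite (inner v)" "finite (innerN v)" "finite (out v)" "finite (cut G C)" "finite T" for v
    using finE finN by (auto simp: inner_def innerN_def out_def cut_def T_def)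
  have degree: "mdegree G v = card (inner v) + card (out v)" if "v \<in> C" for v
  proof -
    have "{e \<in> medges G. v \<in> mends G e} = inner v \<union> out v" "inner v \<inter> out v = {}"
      using that by (auto simp: inner_def out_def cut_def)
    then show ?thesis using fin by (simp add: mdegree_def card_Un_disjoint)
  qed
  have inner_le: "card (inner v) \<le> card (innerN v) + m" if "v \<in> C" for v
  proof -
    have "card (inner v) \<le> card (innerN v \<union> {e \<in> medges G - N. v \<in> mends G e})"
      using fin finE by (intro card_mono) (auto simp: inner_def innerN_def)
    also have "\<dots> \<le> card (innerN v) + m" using deg[of v] that C by (intro order.trans[OF card_Un_le]) auto
    finally show ?thesis .
  qed
  consider "X = {}" | v where "X = {v}" | "2 \<le> card X"
  proof (cases "card X = 0 \<or> card X = 1")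
    case True
    then show thesis using that finX by (auto simp: card_1_singleton_iff)
  next
    case False
    then show thesis using that(3) by linarith
  qed
  then show ?thesis
  proof cases
    case 1
    then show ?thesis using card_cut_ge_if_edge_connected[OF G k C(1)] nontriv C(2) by auto
  next
    case (2 v)
    then have v: "v \<in> C" using X by auto
    have "T = innerN v" using 2 by (auto simp: T_def innerN_def)
    \<comment> \<open>Comparing the cuts of \<open>C\<close> and \<open>C - {v}\<close> gives
      \<open>2 * m + out \<le> cut + inner\<close>; adding \<open>inner\<close> and using
      \<open>inner \<le> innerN + m\<close> twice cancels \<open>2 * m\<close>.\<close>
    moreover have "card (inner v) + card (out v) \<le> card (cut G C) + 2 * card (innerN v)"
    proof (cases "C = {v}")
      case True
      \<comment> \<open>Here \<open>C - {v}\<close> is empty and has no cut bound, but without loops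
        there are no inner edges either.\<close>
      have "mends G e \<noteq> {v}" "mends G e \<noteq> {}" if "e \<in> medges G" for e using ends(2)[OF that] by auto
      then have "inner v = {}" using True by (auto simp: inner_def subset_singleton_iff)
      moreover have "card (out v) \<le> card (cut G C)" using fin by (intro card_mono) (auto simp: out_def)
      ultimately show ?thesis by simp
    next
      case False
      have "cut G (C - {v}) \<subseteq> (cut G C - out v) \<union> inner v"
      proof
        fix e assume e: "e \<in> cut G (C - {v})"
        then have "e \<in> medges G" by (simp add: cut_def)
        then obtain x y where "mends G e = {x, y}" using multigraph_ends[OF G] by metis
        \<comment> \<open>needs that \<open>e\<close> has only two ends: one at \<open>v\<close>, one in \<open>C - {v}\<close> and one outside \<open>C\<close> would break it\<close>
        then show "e \<in> (cut G C - out v) \<union> inner v"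
          using e v by (auto simp: cut_def out_def inner_def)
      qed
      then have "card (cut G (C - {v})) \<le> card (cut G C - out v) + card (inner v)"
        using fin by (intro order.trans[OF card_mono card_Un_le]) auto
      moreover have "card (cut G C - out v) + card (out v) = card (cut G C)"
        using card_Diff_subset[of "out v" "cut G C"] card_mono[of "cut G C" "out v"] fin
        by (auto simp: out_def)
      moreover have "2 * m \<le> card (cut G (C - {v}))"
        using False v C by (intro card_cut_ge_if_edge_connected[OF G k]) auto
      ultimately show ?thesis using inner_le[OF v] by linarith
    qed
    ultimately show ?thesis using 2 degree[OF v] by (simp add: T_def)
  next
    case 3
    \<comment> \<open>An inner edge is counted at up to two vertices of \<open>X\<close>, a cut edge
      at only one, as its other end is outside \<open>C\<close>. No cut bound enters in this
      case.\<close>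
    have "(\<Sum>v\<in>X. card {e \<in> T. v \<in> mends G e}) \<le> 2 * card T"
    proof (intro sum_card_incident_le finX fin)
      fix e assume "e \<in> T"
      then have "e \<in> medges G" using N by (auto simp: T_def)
      then show "card {v \<in> X. v \<in> mends G e} \<le> 2"
        using ends[of e] card_mono[of "mends G e" "{v \<in> X. v \<in> mends G e}"] by auto
    qed
    moreover have "{e \<in> T. v \<in> mends G e} = innerN v" if "v \<in> X" for v
      using that by (auto simp: T_def innerN_def)
    ultimately have sumN: "(\<Sum>v\<in>X. card (innerN v)) \<le> 2 * card T" by simp
    have "(\<Sum>v\<in>X. card (out v)) \<le> 1 * card (cut G C)"
      unfolding out_def
    proof (intro sum_card_incident_le finX fin)
      fix e assume e: "e \<in> cut G C"
      then have "e \<in> medges G" "{v \<in> X. v \<in> mends G e} \<subset> mends G e" using X by (auto simp: cut_def)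
      then show "card {v \<in> X. v \<in> mends G e} \<le> 1"
        using ends[of e] psubset_card_mono[of "mends G e" "{v \<in> X. v \<in> mends G e}"] by auto
    qed
    moreover have "(\<Sum>v\<in>X. mdegree G v) \<le> (\<Sum>v\<in>X. card (innerN v) + m + card (out v))"
      using degree inner_le X by (intro sum_mono) (auto simp: subset_iff)
    ultimately have "(\<Sum>v\<in>X. mdegree G v) \<le> 2 * card T + m * card X + card (cut G C)"
      using sumN by (simp add: sum.distrib mult.commute)
    \<comment> \<open>Only \<open>m * card X\<close> has been spent so far; two vertices in
      \<open>X\<close> suffice to cover the \<open>2 * m\<close> on the left.\<close>
    moreover have "m * 2 \<le> m * card X" using 3 by (rule mult_le_mono2)
    ultimately show ?thesis unfolding T_def by linarith
  qed
qed

text \<open>An edge in the cut of one part lies inside no part, and its two ends meet at most two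
  parts.\<close>

lemma sum_card_cut_components_le:
  assumes G: "multigraph G" and A: "A \<subseteq> medges G"
  shows "(\<Sum>C\<in>components G A. card (cut G C)) \<le> 2 * card {e \<in> medges G. \<forall>C\<in>components G A. \<not> mends G e \<subseteq> C}"
proof -
  define P where "P = components G A"
  define S where "S = {e \<in> medges G. \<forall>C\<in>P. \<not> mends G e \<subseteq> C}"
  have fin: "finite P" "finite S"
    using G finite_components[of G A] by (auto simp: multigraph_def P_def S_def)
  have disj: "C \<inter> C' = {}" if "C \<in> P" "C' \<in> P" "C \<noteq> C'" for C C'
    using quotient_disj[OF equiv_connection] that unfolding P_def components_def by blast
  have "cut G C = {e \<in> S. C \<in> {C'. mends G e \<inter> C' \<noteq> {}}}" if C: "C \<in> P" for C
  proof -
    have "\<not> mends G e \<subseteq> C'" if "e \<in> cut G C" "C' \<in> P" for e C'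
      using disj[OF C \<open>C' \<in> P\<close>] that by (auto simp: cut_def)
    then show ?thesis using C by (auto simp: S_def cut_def)
  qed
  then have "(\<Sum>C\<in>P. card (cut G C)) = (\<Sum>C\<in>P. card {e \<in> S. C \<in> {C'. mends G e \<inter> C' \<noteq> {}}})"
    by (intro sum.cong) auto
  also have "\<dots> \<le> 2 * card S"
  proof (intro sum_card_incident_le fin)
    fix e assume "e \<in> S"
    then have "e \<in> medges G" by (simp add: S_def)
    then obtain x y where e: "mends G e = {x, y}" "x \<in> mverts G" "y \<in> mverts G"
      using multigraph_ends[OF G] by metis
    define cls where "cls a = connection G A `` {a}" for a
    have cls: "cls a \<in> P" "a \<in> cls a" if "a \<in> mverts G" for a
      using that by (auto simp: cls_def P_def components_def quotient_def connection_def)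
    have "C = cls a" if "C \<in> P" "a \<in> C" "a \<in> mverts G" for C a
      using disj[OF that(1) cls(1)[OF that(3)]] cls(2)[OF that(3)] that(2) by auto
    then have "{C \<in> P. C \<in> {C'. mends G e \<inter> C' \<noteq> {}}} \<subseteq> {cls x, cls y}"
      using e by auto
    then have "card {C \<in> P. C \<in> {C'. mends G e \<inter> C' \<noteq> {}}} \<le> card {cls x, cls y}"
      by (intro card_mono) auto
    also have "\<dots> \<le> 2" by (rule card_insert_le_m1) auto
    finally show "card {C \<in> P. C \<in> {C'. mends G e \<inter> C' \<noteq> {}}} \<le> 2" .
  qed
  finally show ?thesis by (simp add: S_def P_def)
qed

text \<open>The sum of the bounds for the single parts. One part with empty \<open>X\<close> has to
  be excluded: for \<open>A = medges G\<close> the claim would then read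
  \<open>2 * m \<le> 0\<close>.\<close>

lemma degree_bound:
  assumes G: "multigraph G" and k: "edge_connected (2 * m) G"
    and N: "N \<subseteq> medges G" and deg: "\<And>v. v \<in> mverts G \<Longrightarrow> card {e \<in> medges G - N. v \<in> mends G e} \<le> m"
    and X: "X \<subseteq> mverts G" and A: "A \<subseteq> medges G"
    and nontriv: "card (components G A) \<noteq> 1 \<or> X \<noteq> {}"
  shows "(\<Sum>v\<in>X. mdegree G v) + 2 * m * card (components G A)
    \<le> 2 * (card (medges G - A) + (\<Sum>v\<in>X. card {e \<in> A \<inter> N. v \<in> mends G e})) + 2 * m * card X"
proof -
  define P where "P = components G A"
  define S where "S = {e \<in> medges G. \<forall>C\<in>P. \<not> mends G e \<subseteq> C}"
  define T where "T C = {e \<in> N. mends G e \<subseteq> C \<and> mends G e \<inter> (X \<inter> C) \<noteq> {}}" for C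
  have finE: "finite (medges G)" and finV: "finite (mverts G)" using G by (auto simp: multigraph_def)
  have finN: "finite N" and finX: "finite X" using N X finE finV by (auto dest: finite_subset)
  have finP: "finite P" unfolding P_def by (rule finite_components[OF finV])
  have disj: "C \<inter> C' = {}" if "C \<in> P" "C' \<in> P" "C \<noteq> C'" for C C'
    using quotient_disj[OF equiv_connection] that unfolding P_def components_def by blast
  have P_ne: "C \<noteq> {}" if "C \<in> P" for C
    using that in_quotient_imp_non_empty[OF equiv_connection] unfolding P_def components_def by blast
  have P_sub: "C \<subseteq> mverts G" if "C \<in> P" for C
    using that components_subset unfolding P_def by blast
  have P_Union: "\<Union>P = mverts G"
    unfolding P_def components_def by (rule Union_quotient[OF equiv_connection])
  have X_Union: "X = (\<Union>C\<in>P. X \<inter> C)" using X P_Union by auto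
  have sum_X: "(\<Sum>C\<in>P. sum g (X \<inter> C)) = sum g X" for g :: "'a \<Rightarrow> nat"
    by (subst (2) X_Union, subst sum.UNION_disjoint) (use finP finX disj in blast)+
  have "(\<Sum>v\<in>X \<inter> C. mdegree G v) + 2 * m \<le> card (cut G C) + 2 * card (T C) + 2 * m * card (X \<inter> C)"
    if C: "C \<in> P" for C
  proof -
    have "C \<noteq> mverts G \<or> X \<inter> C \<noteq> {}"
    proof (rule ccontr)
      assume "\<not> ?thesis"
      then have "C = mverts G" "X = {}" using X by auto
      moreover have "P = {C}" using P_ne P_sub disj C \<open>C = mverts G\<close> by blast
      ultimately show False using nontriv by (simp add: P_def)
    qed
    then show ?thesis unfolding T_def
      by (intro part_degree_bound[OF G k N deg P_ne[OF C] P_sub[OF C]]) auto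
  qed
  then have "(\<Sum>C\<in>P. (\<Sum>v\<in>X \<inter> C. mdegree G v) + 2 * m)
      \<le> (\<Sum>C\<in>P. card (cut G C) + 2 * card (T C) + 2 * m * card (X \<inter> C))"
    by (rule sum_mono)
  then have "(\<Sum>v\<in>X. mdegree G v) + 2 * m * card P
      \<le> (\<Sum>C\<in>P. card (cut G C)) + 2 * (\<Sum>C\<in>P. card (T C)) + 2 * m * card X"
    using sum_X[of "mdegree G"] sum_X[of "\<lambda>_. 1"]
    by (simp add: sum.distrib sum_distrib_right[symmetric] mult.commute)
  moreover have "(\<Sum>C\<in>P. card (cut G C)) \<le> 2 * card S"
    unfolding S_def P_def by (rule sum_card_cut_components_le[OF G A])
  \<comment> \<open>Edges between parts are outside \<open>A\<close>. An edge counted in some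
    \<open>T C\<close> is either outside \<open>A\<close> too or appears among the edges of
    \<open>A \<inter> N\<close> at one of its ends in \<open>X\<close>.\<close>
  moreover have "card S + (\<Sum>C\<in>P. card (T C))
      \<le> card (medges G - A) + (\<Sum>v\<in>X. card {e \<in> A \<inter> N. v \<in> mends G e})"
  proof -
    have finT: "finite (T C)" for C using finN by (simp add: T_def)
    have T_disj: "T C \<inter> T C' = {}" if "C \<in> P" "C' \<in> P" "C \<noteq> C'" for C C'
      using disj[OF that] unfolding T_def by blast
    have "(\<Sum>C\<in>P. card (T C)) = card (\<Union>C\<in>P. T C)"
      using finP finT T_disj by (intro card_UN_disjoint[symmetric]) auto
    moreover have "S \<inter> (\<Union>C\<in>P. T C) = {}" by (auto simp: S_def T_def)
    ultimately have "card S + (\<Sum>C\<in>P. card (T C)) = card (S \<union> (\<Union>C\<in>P. T C))"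
      using finE finP finT by (simp add: card_Un_disjoint S_def)
    also have "\<dots> \<le> card ((medges G - A) \<union> (\<Union>v\<in>X. {e \<in> A \<inter> N. v \<in> mends G e}))"
    proof (rule card_mono)
      show "finite (medges G - A \<union> (\<Union>v\<in>X. {e \<in> A \<inter> N. v \<in> mends G e}))"
        using finE finN finX by auto
      have "e \<notin> A" if "e \<in> S" for e
      proof
        assume e: "e \<in> A"
        then obtain x y where "mends G e = {x, y}" "x \<in> mverts G"
          using multigraph_ends[OF G] A by (metis subsetD)
        then have "mends G e \<subseteq> connection G A `` {x}" "connection G A `` {x} \<in> P"
          using connection_edge[OF G e A] by (auto simp: P_def components_def quotient_def)
        then show False using that by (auto simp: S_def)
      qed
      then show "S \<union> (\<Union>C\<in>P. T C) \<subseteq> (medges G - A) \<union> (\<Union>v\<in>X. {e \<in> A \<inter> N. v \<in> mends G e})"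
        using N by (auto simp: S_def T_def)
    qed
    also have "\<dots> \<le> card (medges G - A) + card (\<Union>v\<in>X. {e \<in> A \<inter> N. v \<in> mends G e})"
      by (rule card_Un_le)
    also have "\<dots> \<le> card (medges G - A) + (\<Sum>v\<in>X. card {e \<in> A \<inter> N. v \<in> mends G e})"
      using finX by (intro add_left_mono card_UN_le)
    finally show ?thesis .
  qed
  ultimately show ?thesis by (simp add: P_def)
qed

section \<open>Disjoint trees and stars\<close>

lemma factor_of_medges_update:
  assumes "multigraph G" "S \<subseteq> S'" "S' \<subseteq> medges G"
  shows "factor_of (G\<lparr>medges := S\<rparr>) (G\<lparr>medges := S'\<rparr>)"
proof -
  have "finite S" using assms by (auto simp: multigraph_def dest: finite_subset)
  then show ?thesis using assms by (auto simp: factor_of_def multigraph_def)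
qed

text \<open>Degree 0 occurs for the one-vertex graph, which is edge-connected to every
  order.\<close>

lemma mdegree_eq_0_or_ge:
  assumes G: "multigraph G" and k: "edge_connected k G" and v: "v \<in> mverts G"
  shows "mdegree G v = 0 \<or> k \<le> mdegree G v"
proof (cases "mverts G = {v}")
  case True
  have "v \<notin> mends G e" if "e \<in> medges G" for e
    using multigraph_ends[OF G that] True by (metis singletonD)
  then show ?thesis by (simp add: mdegree_def cong: conj_cong)
next
  case False
  have "k \<le> card (cut G {v})"
    using False v by (intro card_cut_ge_if_edge_connected[OF G k]) auto
  also have "\<dots> \<le> mdegree G v"
    using G unfolding mdegree_def multigraph_def by (intro card_mono) (auto simp: cut_def)
  finally show ?thesis by simp
qed

theorem disjoint_trees_and_stars:
  fixes G :: "('v, 'e) mgraph"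
  assumes G: "multigraph G" and k: "edge_connected (2 * m) G" and u: "u \<in> mverts G"
    and N: "N \<subseteq> medges G" and deg: "\<And>v. v \<in> mverts G \<Longrightarrow> card {e \<in> medges G - N. v \<in> mends G e} \<le> m"
  defines "l \<equiv> \<lambda>v. if v = u then (mdegree G v + 1) div 2 else mdegree G v div 2 - m"
  obtains T :: "nat \<Rightarrow> 'e set" and S :: "'v \<Rightarrow> 'e set"
  where "\<And>i. i < m \<Longrightarrow> T i \<subseteq> medges G" "\<And>i. i < m \<Longrightarrow> is_tree (G\<lparr>medges := T i\<rparr>)"
    "\<And>v. v \<in> mverts G \<Longrightarrow> S v \<subseteq> {e \<in> N. v \<in> mends G e}" "\<And>v. v \<in> mverts G \<Longrightarrow> card (S v) = l v"
    "\<And>i j. i < m \<Longrightarrow> j < m \<Longrightarrow> i \<noteq> j \<Longrightarrow> T i \<inter> T j = {}"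
    "\<And>v w. v \<in> mverts G \<Longrightarrow> w \<in> mverts G \<Longrightarrow> v \<noteq> w \<Longrightarrow> S v \<inter> S w = {}"
    "\<And>i v. i < m \<Longrightarrow> v \<in> mverts G \<Longrightarrow> T i \<inter> S v = {}"
proof -
  have finE: "finite (medges G)" and finV: "finite (mverts G)" using G by (auto simp: multigraph_def)
  have finN: "finite N" using N finE by (rule finite_subset)
  have V: "mverts G \<noteq> {}" using u by auto
  define a where "a v A = card {e \<in> A \<inter> N. v \<in> mends G e}" for v A
  \<comment> \<open>In the matroid of a vertex \<open>v\<close>, all edges outside \<open>N\<close>
    or not at \<open>v\<close> are loops.\<close>
  define r where "r j = (case j of Inl (i :: nat) \<Rightarrow> graph_rank G | Inr v \<Rightarrow> \<lambda>A. min (l v) (a v A))" for j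
  define J where "J = {..<m} <+> mverts G"
  have finJ: "finite J" using finV by (simp add: J_def)
  have "matroid_rank (medges G) (\<lambda>A. min (l v) (a v A))" for v
  proof (rule matroid_rankI)
    fix A assume "A \<subseteq> medges G"
    then have "a v A \<le> card A"
      using finE unfolding a_def by (intro card_mono) (auto dest: finite_subset)
    then show "min (l v) (a v A) \<le> card A" by simp
  next
    fix A B assume "A \<subseteq> B" "B \<subseteq> medges G"
    then have "a v A \<le> a v B" using finN unfolding a_def by (intro card_mono) auto
    then show "min (l v) (a v A) \<le> min (l v) (a v B)" by simp
  next
    fix A B
    have "{e \<in> (A \<union> B) \<inter> N. v \<in> mends G e} = {e \<in> A \<inter> N. v \<in> mends G e} \<union> {e \<in> B \<inter> N. v \<in> mends G e}"
      "{e \<in> (A \<inter> B) \<inter> N. v \<in> mends G e} = {e \<in> A \<inter> N. v \<in> mends G e} \<inter> {e \<in> B \<inter> N. v \<in> mends G e}"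
      by auto
    \<comment> \<open>\<open>a v\<close> is modular and monotone, and capping such a function at a
      constant leaves it submodular.\<close>
    then have "a v (A \<union> B) + a v (A \<inter> B) = a v A + a v B"
      using finN by (simp add: a_def card_Un_Int[symmetric])
    moreover have "a v (A \<inter> B) \<le> a v A" "a v (A \<inter> B) \<le> a v B"
      using finN unfolding a_def by (auto intro!: card_mono)
    ultimately show "min (l v) (a v (A \<union> B)) + min (l v) (a v (A \<inter> B)) \<le> min (l v) (a v A) + min (l v) (a v B)"
      by linarith
  qed
  then have rank: "matroid_rank (medges G) (r j)" for j
    using matroid_rank_graph_rank[OF G] by (cases j) (simp_all add: r_def)
  have "mconnected (G\<lparr>medges := medges G\<rparr>)" if "0 < m"
    using k[unfolded edge_connected_def, rule_format, of "{}"] that by (simp add: delete_edges_def)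
  then have r_Inl: "r (Inl i) (medges G) = card (mverts G) - 1" if "i < m" for i
    using that mconnected_iff_card_components[OF G V, of "medges G"]
    by (auto simp: r_def graph_rank_def)
  have r_Inr: "r (Inr v) (medges G) = l v" if v: "v \<in> mverts G" for v
  proof -
    have "{e \<in> medges G. v \<in> mends G e} = {e \<in> medges G \<inter> N. v \<in> mends G e} \<union> {e \<in> medges G - N. v \<in> mends G e}"
      by auto
    then have "mdegree G v \<le> a v (medges G) + card {e \<in> medges G - N. v \<in> mends G e}"
      by (simp add: mdegree_def a_def card_Un_le)
    then have "mdegree G v \<le> a v (medges G) + m" using deg[OF v] by linarith
    \<comment> \<open>For degree \<open>d \<ge> 2 * m\<close>, both \<open>d div 2 - m\<close> and
      \<open>(d + 1) div 2\<close> are at most \<open>d - m\<close>.\<close>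
    then have "l v \<le> a v (medges G)" using mdegree_eq_0_or_ge[OF G k v] by (auto simp: l_def)
    then show ?thesis by (simp add: r_def)
  qed
  have bound: "(\<Sum>j\<in>J. r j (medges G)) \<le> (\<Sum>j\<in>J. r j A) + card (medges G - A)" if A: "A \<subseteq> medges G" for A
  proof -
    define c where "c = card (components G A)"
    \<comment> \<open>Outside \<open>X\<close> the minimum is \<open>l v\<close> and cancels with
      the same term on the left.\<close>
    define X where "X = {v \<in> mverts G. a v A < l v}"
    have finX: "finite X" using finV by (simp add: X_def)
    have c: "1 \<le> c" "c \<le> card (mverts G)"
      using card_components_le[OF finV] card_components_pos[OF finV V] by (auto simp: c_def)
    have split: "sum f (mverts G) = sum f X + sum f (mverts G - X)" for f :: "'v \<Rightarrow> nat"
      using sum.subset_diff[of X "mverts G" f] finV by (simp add: X_def)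
    have "sum l X + m * c \<le> m + sum (\<lambda>v. a v A) X + card (medges G - A)"
    proof (cases "c = 1 \<and> X = {}")
      case False
      then have 1: "sum (mdegree G) X + 2 * m * c
          \<le> 2 * (card (medges G - A) + sum (\<lambda>v. a v A) X) + 2 * m * card X"
        using degree_bound[OF G k N deg _ A, of X] by (auto simp: c_def X_def a_def)
      \<comment> \<open>On \<open>X\<close> the value \<open>l v\<close> is positive, so its
        subtraction is not truncated. Only \<open>u\<close> exceeds its degree, by at most
        \<open>2 * m + 1\<close>.\<close>
      have "(\<Sum>v\<in>X. 2 * l v + 2 * m) \<le> (\<Sum>v\<in>X. mdegree G v + (if v = u then 2 * m + 1 else 0))"
        by (intro sum_mono) (auto simp: X_def l_def)
      also have "\<dots> \<le> sum (mdegree G) X + (2 * m + 1)"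
        using finX by (simp add: sum.distrib sum.delta)
      finally have "2 * sum l X + 2 * m * card X \<le> sum (mdegree G) X + (2 * m + 1)"
        by (simp only: sum.distrib sum_distrib_left[symmetric] sum_constant of_nat_id mult.commute[of "card X"])
      \<comment> \<open>Apart from the odd unit at \<open>u\<close>, all terms are even, so halving
        discards it and leaves exactly the slack \<open>m\<close>.\<close>
      with 1 show ?thesis by (simp add: mult.assoc)
    qed simp
    moreover note split[of l] split[of "\<lambda>v. r (Inr v) A"]
    moreover have "sum (\<lambda>v. r (Inr v) A) X = sum (\<lambda>v. a v A) X"
      by (intro sum.cong) (auto simp: r_def X_def)
    moreover have "sum (\<lambda>v. r (Inr v) A) (mverts G - X) = sum l (mverts G - X)"
      by (intro sum.cong) (auto simp: r_def X_def)
    moreover have "m * (card (mverts G) - 1) + m = m * (card (mverts G) - c) + m * c"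
    proof -
      have "card (mverts G) - 1 + 1 = card (mverts G) - c + c" using c by simp
      then have "m * (card (mverts G) - 1 + 1) = m * (card (mverts G) - c + c)" by (rule arg_cong)
      then show ?thesis by (simp only: add_mult_distrib2 mult_1_right)
    qed
    ultimately have "m * (card (mverts G) - 1) + sum l (mverts G)
        \<le> m * (card (mverts G) - c) + sum (\<lambda>v. r (Inr v) A) (mverts G) + card (medges G - A)"
      by linarith
    moreover have J: "(\<Sum>j\<in>J. r j B) = (\<Sum>i<m. r (Inl i) B) + (\<Sum>v\<in>mverts G. r (Inr v) B)" for B
      using finV by (simp add: J_def sum.Plus)
    moreover have "(\<Sum>i<m. r (Inl i) (medges G)) = m * (card (mverts G) - 1)"
      "(\<Sum>v\<in>mverts G. r (Inr v) (medges G)) = sum l (mverts G)"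
      "(\<Sum>i<m. r (Inl i) A) = m * (card (mverts G) - c)"
      using r_Inl r_Inr by (simp_all add: r_def[of "Inl _"] graph_rank_def c_def)
    ultimately show ?thesis by simp
  qed
  obtain I where I: "\<And>j. j \<in> J \<Longrightarrow> I j \<subseteq> medges G" "\<And>j. j \<in> J \<Longrightarrow> card (I j) = r j (medges G)"
    "\<And>j. j \<in> J \<Longrightarrow> r j (I j) = r j (medges G)"
    "\<And>i j. i \<in> J \<Longrightarrow> j \<in> J \<Longrightarrow> i \<noteq> j \<Longrightarrow> I i \<inter> I j = {}"
    using matroid_union[OF finE finJ rank bound] by metis
  show thesis
  proof (rule that[of "\<lambda>i. I (Inl i)" "\<lambda>v. I (Inr v)"])
    fix i assume "i < m"
    then have i: "Inl i \<in> J" by (auto simp: J_def)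
    show "I (Inl i) \<subseteq> medges G" using I(1)[OF i] .
    show "is_tree (G\<lparr>medges := I (Inl i)\<rparr>)"
      using I(1-3)[OF i] r_Inl[OF \<open>i < m\<close>]
      by (intro spanning_tree_if_graph_rank[OF G V]) (simp_all add: r_def)
  next
    fix v assume v: "v \<in> mverts G"
    then have j: "Inr v \<in> J" by (auto simp: J_def)
    show card: "card (I (Inr v)) = l v" using I(2)[OF j] r_Inr[OF v] by simp
    \<comment> \<open>The chosen set has \<open>l v\<close> elements, and at least
      \<open>l v\<close> of them are edges of \<open>N\<close> at \<open>v\<close>; hence all
      are.\<close>
    have "l v \<le> a v (I (Inr v))" using I(3)[OF j] r_Inr[OF v] by (simp add: r_def)
    then have "{e \<in> I (Inr v) \<inter> N. v \<in> mends G e} = I (Inr v)"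
      using card I(1)[OF j] finE unfolding a_def by (intro card_seteq) (auto dest: finite_subset)
    then show "I (Inr v) \<subseteq> {e \<in> N. v \<in> mends G e}" by blast
  qed (rule I(4); force simp: J_def)+
qed

section \<open>Assembling the two factors and the orientation\<close>

theorem theorem5p8:
  fixes G M :: "('v, 'e) mgraph" and m :: nat
  assumes "m \<ge> 1"
    and "multigraph G"
    and "edge_connected (2 * m) G"
    and "factor_of M G"
    and "max_degree M \<le> m"
  shows "(\<exists>H F D. decomposes G H F \<and> tree_connected m H \<and> factor_of M H \<and> orientation_of D F \<and>
            (\<forall>v\<in>mverts G. int (out_degree D v) \<ge> \<lfloor>real (mdegree G v) / 2\<rfloor> - int m)) \<and>
         (\<forall>u\<in>mverts G.
            \<exists>H F D. decomposes G H F \<and> tree_connected m H \<and> factor_of M H \<and> orientation_of D F \<and>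
            (\<forall>v\<in>mverts G. int (out_degree D v) \<ge> \<lfloor>real (mdegree G v) / 2\<rfloor> - int m) \<and>
            int (out_degree D u) \<ge> \<lceil>real (mdegree G u) / 2\<rceil>)"
proof -
  note G = assms(2) and k = assms(3) and M = assms(4)
  have finV: "finite (mverts G)" using G by (simp add: multigraph_def)
  have "mconnected (delete_edges G {})" using k assms(1) by (auto simp: edge_connected_def)
  then have V: "mverts G \<noteq> {}" by (simp add: mconnected_def delete_edges_def)
  \<comment> \<open>Stars taken from \<open>N\<close> avoid \<open>M\<close>, so the remainder
    \<open>H\<close> contains \<open>M\<close>; the bound on the degrees of \<open>M\<close> limits
    how many edges at a vertex are lost.\<close>
  define N where "N = medges G - medges M"
  have N_subset: "N \<subseteq> medges G" by (auto simp: N_def)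
  have M': "medges M \<subseteq> medges G" "mverts M = mverts G" "\<And>e. e \<in> medges M \<Longrightarrow> mends M e = mends G e"
    "multigraph M"
    using M by (auto simp: factor_of_def)
  have deg: "card {e \<in> medges G - N. v \<in> mends G e} \<le> m" if v: "v \<in> mverts G" for v
  proof -
    have "{e \<in> medges G - N. v \<in> mends G e} = {e \<in> medges M. v \<in> mends M e}"
      using M' by (auto simp: N_def)
    moreover have "mdegree M v \<le> max_degree M"
      using v finV M'(2) unfolding max_degree_def by (intro Max_ge) auto
    ultimately show ?thesis using assms(5) by (simp add: mdegree_def)
  qed
  have main: "\<exists>H F D. decomposes G H F \<and> tree_connected m H \<and> factor_of M H \<and> orientation_of D F \<and>
      (\<forall>v\<in>mverts G. int (out_degree D v) \<ge> \<lfloor>real (mdegree G v) / 2\<rfloor> - int m) \<and>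
      int (out_degree D u) \<ge> \<lceil>real (mdegree G u) / 2\<rceil>" if u: "u \<in> mverts G" for u
  proof -
    define l where "l v = (if v = u then (mdegree G v + 1) div 2 else mdegree G v div 2 - m)" for v
    obtain T S where T: "\<And>i. i < m \<Longrightarrow> T i \<subseteq> medges G" "\<And>i. i < m \<Longrightarrow> is_tree (G\<lparr>medges := T i\<rparr>)"
      and S: "\<And>v. v \<in> mverts G \<Longrightarrow> S v \<subseteq> {e \<in> N. v \<in> mends G e}" "\<And>v. v \<in> mverts G \<Longrightarrow> card (S v) = l v"
      and disj: "\<And>i j. i < m \<Longrightarrow> j < m \<Longrightarrow> i \<noteq> j \<Longrightarrow> T i \<inter> T j = {}"
        "\<And>v w. v \<in> mverts G \<Longrightarrow> w \<in> mverts G \<Longrightarrow> v \<noteq> w \<Longrightarrow> S v \<inter> S w = {}"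
        "\<And>i v. i < m \<Longrightarrow> v \<in> mverts G \<Longrightarrow> T i \<inter> S v = {}"
      using disjoint_trees_and_stars[OF G k u N_subset deg] unfolding l_def by blast
    define A where "A = (\<Union>v\<in>mverts G. S v)"
    have A: "A \<subseteq> medges G" "A \<inter> medges M = {}" using S(1) by (force simp: A_def N_def)+
    define H where "H = G\<lparr>medges := medges G - A\<rparr>"
    define F where "F = G\<lparr>medges := A\<rparr>"
    \<comment> \<open>The centre of the star containing \<open>e\<close>, unique as the stars are
      disjoint. With centres as tails, the out-arcs of \<open>v\<close> are exactly
      \<open>S v\<close>.\<close>
    define t where "t e = (SOME v. v \<in> mverts G \<and> e \<in> S v)" for e
    define D where "D = \<lparr>verts = mverts G, arcs = A, tail = t, head = \<lambda>e. SOME w. mends G e = {t e, w}\<rparr>"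
    have t: "t e = v" if "v \<in> mverts G" "e \<in> S v" for e v
      unfolding t_def by (rule some_equality) (use that disj(2) in auto)
    have "decomposes G H F"
      using factor_of_medges_update[OF G _ subset_refl, of A] factor_of_medges_update[OF G _ subset_refl, of "medges G - A"] A
      by (auto simp: decomposes_def H_def F_def)
    moreover have "tree_connected m H"
      unfolding tree_connected_def
    proof (intro exI[of _ "\<lambda>i. G\<lparr>medges := T i\<rparr>"] conjI allI impI)
      fix i assume "i < m"
      then show "factor_of (G\<lparr>medges := T i\<rparr>) H"
        unfolding H_def using T(1)[of i] disj(3)[of i]
        by (intro factor_of_medges_update[OF G]) (auto simp: A_def)
    qed (use T disj in auto)
    moreover have "factor_of M H"
      using M A by (auto simp: factor_of_def H_def)
    moreover have "orientation_of D F"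
    proof -
      have "{t e, SOME w. mends G e = {t e, w}} = mends G e" if e: "e \<in> A" for e
      proof -
        obtain v where v: "v \<in> mverts G" "e \<in> S v" using e by (auto simp: A_def)
        then have "t e \<in> mends G e" using S(1)[OF v(1)] t by auto
        moreover have "e \<in> medges G" using e A by auto
        then obtain x y where "mends G e = {x, y}" using multigraph_ends[OF G] by metis
        ultimately have "\<exists>w. mends G e = {t e, w}" by auto
        from someI_ex[OF this] show ?thesis by (rule sym)
      qed
      then show ?thesis by (simp add: orientation_of_def D_def F_def)
    qed
    moreover have out: "out_degree D v = l v" if v: "v \<in> mverts G" for v
    proof -
      have "out_arcs D v = S v" using t v by (auto simp: out_arcs_def D_def A_def)
      then show ?thesis using S(2)[OF v] by (simp add: out_degree_def)
    qed
    moreover have "\<lfloor>real (mdegree G v) / 2\<rfloor> = int (mdegree G v div 2)" for v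
      using floor_divide_of_nat_eq[of "mdegree G v" 2] by simp
    moreover have "\<lceil>real (mdegree G u) / 2\<rceil> \<le> int ((mdegree G u + 1) div 2)"
      unfolding ceiling_le_iff by simp
    \<comment> \<open>Truncation in \<open>l\<close> can only raise the value above the integer
      difference, and at \<open>u\<close> the upper half of the degree also satisfies the general
      bound.\<close>
    ultimately show ?thesis
      using u by (intro exI[of _ H] exI[of _ F] exI[of _ D]) (auto simp: l_def)
  qed
  \<comment> \<open>The first conjunct prescribes no vertex, so any vertex serves.\<close>
  from V obtain u where "u \<in> mverts G" by auto
  then show ?thesis using main by blast
qed

end
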